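(* Let $\alpha$ be an integer. If there exists an extremal singly even self-dual $[72,36,14]$ code $C$ whose shadow has minimum weight at least $8$, with weight enumerator \[ W_{72} = 1 + (8640 - 64 \alpha)y^{14} + (124281 + 384 \alpha) y^{16} + \cdots \] and shadow weight enumerator \[ S_{72} = \alpha y^8 + (546 - 14 \alpha) y^{12} + (244584+91 \alpha)y^{16}+ \cdots, \] then $0 \le \alpha \le 14$.
   Context: All codes are binary linear codes; an $[n,k,d]$ code has length $n$, dimension $k$ and minimum nonzero weight $d$. A code $C$ is self-dual if $C=C^\perp$ with respect to the standard inner product; a self-dual code is singly even if it contains a codeword of weight $\equiv 2 \pmod 4$. For a singly even self-dual code $C$, let $C_0$ be the subcode of codewords of weight $\equiv 0 \pmod 4$. The shadow of $C$ is $S=C_0^\perp\setminus C$. The weight enumerators of $C$ and $S$ are $\sum_i A_i y^i$ and $\sum_i B_i y^i$, where $A_i$ and $B_i$ are the numbers of vectors of weight $i$ in $C$ and $S$ respectively; the dots denote terms of higher degree. Extremal means meeting the known upper bound on the minimum weight; for singly even self-dual codes of length $n\equiv 0\pmod{24}$ this bound is $d\le 4\lfloor n/24\rfloor+2$, which is $14$ for $n=72$. Known (Dougherty–Gulliver–Harada): every singly even self-dual $[72,36,14]$ code whose shadow has minimum weight at least $8$ has weight enumerators of the stated form for some integer $\alpha$ with $0\le\alpha\le\lfloor\frac{546}{14}\rfloor=39$. *)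

theory Defs
  imports
    "HOL-Analysis.Analysis"
    "HOL-Library.Z2"
    "HOL-Computational_Algebra.Polynomial"
begin

instance bit :: finite
proof
  have "x \<in> {0, 1}" for x :: bit
    by (cases x) auto
  then have "(UNIV :: bit set) \<subseteq> {0, 1}"
    by blast
  then show "finite (UNIV :: bit set)"
    by (rule finite_subset) simp
qed

definition weight :: "bit ^ 'n \<Rightarrow> nat"
  where "weight x = card {i. x $ i \<noteq> 0}"

text \<open>
  The shadow of a singly even self-dual code is nonempty and does not contain \<open>0\<close>, so for it the
  minimum nonzero weight is just the minimum weight.
\<close>

definition min_weight :: "(bit ^ 'n) set \<Rightarrow> nat"
  where "min_weight X = Min (weight ` (X - {0}))"

definition is_code :: "(bit ^ 'n) set \<Rightarrow> nat \<Rightarrow> nat \<Rightarrow> nat \<Rightarrow> bool"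
  where "is_code C n k d \<longleftrightarrow>
    vec.subspace C \<and> CARD('n) = n \<and> vec.dim C = k \<and> min_weight C = d"

definition dual_code :: "(bit ^ 'n) set \<Rightarrow> (bit ^ 'n) set"
  where "dual_code C = {x. \<forall>c\<in>C. scalar_product x c = 0}"

definition self_dual :: "(bit ^ 'n) set \<Rightarrow> bool"
  where "self_dual C \<longleftrightarrow> C = dual_code C"

definition singly_even_self_dual :: "(bit ^ 'n) set \<Rightarrow> bool"
  where "singly_even_self_dual C \<longleftrightarrow> self_dual C \<and> (\<exists>c\<in>C. weight c mod 4 = 2)"

definition doubly_even_subcode :: "(bit ^ 'n) set \<Rightarrow> (bit ^ 'n) set"
  where "doubly_even_subcode C = {c \<in> C. weight c mod 4 = 0}"

definition shadow :: "(bit ^ 'n) set \<Rightarrow> (bit ^ 'n) set"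
  where "shadow C = dual_code (doubly_even_subcode C) - C"

text \<open>
  For singly even self-dual codes whose length \<open>n\<close> is a multiple of 24, the known upper bound on
  the minimum weight is \<open>4 * (n div 24) + 2\<close>.  Extremality is defined for these lengths only.
\<close>

definition extremal :: "(bit ^ 'n) set \<Rightarrow> bool"
  where "extremal C \<longleftrightarrow> 24 dvd CARD('n) \<and> min_weight C = 4 * (CARD('n) div 24) + 2"

definition weight_enumerator :: "(bit ^ 'n) set \<Rightarrow> int poly"
  where "weight_enumerator X =
    (\<Sum>i\<le>CARD('n). monom (int (card {x \<in> X. weight x = i})) i)"

end

theory Submission
  imports Defs
begin

text \<open>
  Every shadow vector \<open>x\<close> satisfies \<open>\<langle>x, c\<rangle> = 0\<close> for \<open>c\<close> in the doubly even subcode \<open>C\<^sub>0\<close> and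
  \<open>\<langle>x, c\<rangle> = 1\<close> for \<open>c \<in> C - C\<^sub>0\<close>, so an even number of shadow vectors sums to a codeword.
  Two distinct shadow vectors of weight 8 therefore meet in at most one coordinate, since their
  sum has weight at least 14.  Orthogonality is an equivalence relation with at most two classes
  on the shadow vectors of weight 8, and the supports within a class are disjoint.  A class has at
  most 7 elements: the sum of 8 of its elements would be a codeword of weight 64, whose complement
  is a codeword of weight 8.
\<close>

text \<open>These rules rewrite \<open>+\<close> and \<open>*\<close> on bits to bit operations and block the ring laws.\<close>
declare add_bit_eq_xor [simp del] mult_bit_eq_and [simp del]

section \<open>Supports and inner products of binary vectors\<close>

definition support :: "bit ^ 'n \<Rightarrow> 'n set"
  where "support x = {i. x $ i \<noteq> 0}"

lemma weight_eq_card_support: "weight x = card (support x)"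
  by (simp add: weight_def support_def)

lemma weight_zero [simp]: "weight 0 = 0"
  by (simp add: weight_def)

lemma support_add: "support (x + y) = (support x \<union> support y) - (support x \<inter> support y)"
  by (auto simp: support_def)

lemma weight_add:
  "weight (x + y) + 2 * card (support x \<inter> support y) = weight x + weight y"
proof -
  have "card (support x \<inter> support y) \<le> card (support x \<union> support y)"
    by (intro card_mono) auto
  moreover have "weight (x + y) = card (support x \<union> support y) - card (support x \<inter> support y)"
    unfolding weight_eq_card_support support_add by (rule card_Diff_subset) auto
  ultimately show ?thesis
    using card_Un_Int[of "support x" "support y"] by (simp add: weight_eq_card_support)
qed

lemma of_nat_bit_eq_0_iff: "(of_nat n :: bit) = 0 \<longleftrightarrow> even n"
  by (induction n) auto

lemma bit_add_self: "(b :: bit) + b = 0"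
  by (cases b) auto

lemma bit_vector_add_self: "(x :: bit ^ 'n) + x = 0"
  by (simp add: vec_eq_iff bit_add_self)

lemma scalar_product_eq_card:
  "scalar_product x y = (of_nat (card (support x \<inter> support y)) :: bit)"
proof -
  have "scalar_product x y = (\<Sum>i\<in>UNIV. if i \<in> support x \<inter> support y then 1 else 0)"
    unfolding scalar_product_def by (intro sum.cong) (auto simp: support_def)
  also have "\<dots> = of_nat (card (support x \<inter> support y))"
    by (subst sum.inter_filter [symmetric]) (auto simp: Int_def)
  finally show ?thesis .
qed

lemma scalar_product_eq_0_iff:
  "scalar_product x y = (0 :: bit) \<longleftrightarrow> even (card (support x \<inter> support y))"
  by (simp add: scalar_product_eq_card of_nat_bit_eq_0_iff)

lemma scalar_product_self_eq_0_iff: "scalar_product x x = (0 :: bit) \<longleftrightarrow> even (weight x)"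
  by (simp add: scalar_product_eq_0_iff weight_eq_card_support)

lemma scalar_product_add_left:
  "scalar_product (x + y) z = scalar_product x z + (scalar_product y z :: bit)"
  by (simp add: scalar_product_def distrib_right sum.distrib)

lemma scalar_product_add_right:
  "scalar_product z (x + y) = scalar_product z x + (scalar_product z y :: bit)"
  by (simp add: scalar_product_def distrib_left sum.distrib)

lemma scalar_product_sum_left:
  assumes "finite F"
  shows "scalar_product (\<Sum>x\<in>F. f x) z = (\<Sum>x\<in>F. scalar_product (f x) z :: bit)"
  using assms by induction (auto simp: scalar_product_add_left, simp add: scalar_product_def)

text \<open>The support is carried along with the weight because the induction step needs the new
  vector to be disjoint from the whole partial sum, not just from its summands.\<close>

lemma weight_sum_disjoint:
  fixes F :: "(bit ^ 'n) set"
  assumes "finite F" and "pairwise (\<lambda>x y. support x \<inter> support y = {}) F"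
  shows "weight (\<Sum>F) = (\<Sum>x\<in>F. weight x) \<and> support (\<Sum>F) = (\<Union>x\<in>F. support x)"
  using assms
proof (induction F)
  case empty
  then show ?case by (simp add: support_def)
next
  case (insert x F)
  then have IH: "weight (\<Sum>F) = (\<Sum>x\<in>F. weight x)" "support (\<Sum>F) = (\<Union>x\<in>F. support x)"
    by (simp_all add: pairwise_insert)
  have "support x \<inter> support y = {}" if "y \<in> F" for y
    using insert.prems insert.hyps that by (auto simp: pairwise_insert)
  then have "support x \<inter> support (\<Sum>F) = {}"
    unfolding IH by blast
  then show ?case
    using weight_add[of x "\<Sum>F"] support_add[of x "\<Sum>F"] insert.hyps IH by simp
qed

section \<open>Self-dual codes\<close>

lemma dual_code_add:
  "x \<in> dual_code C \<Longrightarrow> y \<in> dual_code C \<Longrightarrow> x + y \<in> dual_code C"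
  by (simp add: dual_code_def scalar_product_add_left)

lemma self_dual_scalar_product:
  "self_dual C \<Longrightarrow> x \<in> C \<Longrightarrow> y \<in> C \<Longrightarrow> scalar_product x y = 0"
  by (auto simp: self_dual_def dual_code_def)

lemma self_dual_memI:
  "self_dual C \<Longrightarrow> (\<And>c. c \<in> C \<Longrightarrow> scalar_product x c = 0) \<Longrightarrow> x \<in> C"
  by (auto simp: self_dual_def dual_code_def)

lemma self_dual_add: "self_dual C \<Longrightarrow> x \<in> C \<Longrightarrow> y \<in> C \<Longrightarrow> x + y \<in> C"
  using dual_code_add unfolding self_dual_def by blast

lemma self_dual_even_weight: "self_dual C \<Longrightarrow> c \<in> C \<Longrightarrow> even (weight c)"
  by (simp flip: scalar_product_self_eq_0_iff add: self_dual_scalar_product)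

text \<open>The product of a codeword with the all-ones vector is the parity of its weight, and
  codewords are even since they are orthogonal to themselves.\<close>

lemma self_dual_all_ones:
  assumes "self_dual C"
  shows "1 \<in> C"
proof (rule self_dual_memI[OF assms])
  fix c assume "c \<in> C"
  have "support 1 \<inter> support c = support c"
    by (auto simp: support_def)
  then show "scalar_product 1 c = 0"
    using self_dual_even_weight[OF assms \<open>c \<in> C\<close>]
    by (simp add: scalar_product_eq_0_iff weight_eq_card_support)
qed

section \<open>Products and sums of shadow vectors\<close>

text \<open>Since \<open>x\<close> lies outside \<open>C\<close>, which is its own dual, some
  codeword \<open>c'\<close> has nonzero product with \<open>x\<close>; its weight must be 2 mod 4.
  If a codeword \<open>c\<close> of weight 2 mod 4 were orthogonal to \<open>x\<close>, then
  \<open>c + c'\<close> would be doubly even and yet not orthogonal to \<open>x\<close>.\<close>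

lemma shadow_scalar_product:
  assumes C: "self_dual C" and x: "x \<in> shadow C" and c: "c \<in> C"
  shows "scalar_product x c = 0 \<longleftrightarrow> weight c mod 4 = 0"
proof
  assume "weight c mod 4 = 0"
  then show "scalar_product x c = 0"
    using x c by (auto simp: shadow_def dual_code_def doubly_even_subcode_def)
next
  assume xc: "scalar_product x c = 0"
  have "x \<notin> C"
    using x by (simp add: shadow_def)
  then obtain c' where c': "c' \<in> C" "scalar_product x c' \<noteq> 0"
    using self_dual_memI[OF C] by blast
  have orth: "scalar_product x e = 0" if "e \<in> C" "weight e mod 4 = 0" for e
    using x that by (auto simp: shadow_def dual_code_def doubly_even_subcode_def)
  show "weight c mod 4 = 0"
  proof (rule ccontr)
    assume "weight c mod 4 \<noteq> 0"
    moreover have "weight c' mod 4 \<noteq> 0"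
      using orth c' by blast
    moreover have "even (weight c)" "even (weight c')"
      using self_dual_even_weight C c c' by blast+
    moreover have "even (card (support c \<inter> support c'))"
      using self_dual_scalar_product[OF C c c'(1)] by (simp add: scalar_product_eq_0_iff)
    \<comment> \<open>Both weights are 2 mod 4, and twice the even size of the intersection vanishes
      mod 4.\<close>
    ultimately have "weight (c + c') mod 4 = 0"
      using weight_add[of c c'] by presburger
    then have "scalar_product x (c + c') = 0"
      using orth[OF self_dual_add[OF C c c'(1)]] by simp
    then show False
      using xc c'(2) by (simp add: scalar_product_add_right)
  qed
qed

lemma shadow_scalar_product_eq:
  assumes "self_dual C" "x \<in> shadow C" "y \<in> shadow C" "c \<in> C"
  shows "scalar_product x c = scalar_product y c"
  using shadow_scalar_product[OF assms(1,2,4)] shadow_scalar_product[OF assms(1,3,4)]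
  by (metis bit_not_zero_iff)

text \<open>All members of \<open>F\<close> have the same product with a given codeword, so an even
  number of these products cancels.\<close>

lemma sum_shadow_in_code:
  fixes C :: "(bit ^ 'n) set"
  assumes C: "self_dual C" and F: "finite F" "F \<subseteq> shadow C" "even (card F)"
  shows "\<Sum>F \<in> C"
proof (cases "F = {}")
  case True
  then show ?thesis
    using self_dual_memI[OF C, of 0] by (simp add: scalar_product_def)
next
  case False
  then obtain x where x: "x \<in> F" by blast
  show ?thesis
  proof (rule self_dual_memI[OF C])
    fix c assume "c \<in> C"
    have "scalar_product (\<Sum>F) c = (\<Sum>y\<in>F. scalar_product y c)"
      using scalar_product_sum_left[OF F(1), of "\<lambda>x. x"] by simp
    also have "\<dots> = (\<Sum>y\<in>F. scalar_product x c)"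
      using shadow_scalar_product_eq[OF C _ _ \<open>c \<in> C\<close>] x F(2) by (intro sum.cong) auto
    also have "\<dots> = of_nat (card F) * scalar_product x c"
      by simp
    also have "of_nat (card F) = (0 :: bit)"
      using F(3) by (simp add: of_nat_bit_eq_0_iff)
    finally show "scalar_product (\<Sum>F) c = 0"
      by simp
  qed
qed

lemma add_shadow_in_code:
  assumes "self_dual C" "x \<in> shadow C" "y \<in> shadow C"
  shows "x + y \<in> C"
  using shadow_scalar_product_eq[OF assms]
  by (intro self_dual_memI[OF assms(1)]) (simp add: scalar_product_add_left bit_add_self)

section \<open>Shadow vectors of weight 8\<close>

lemma min_weight_le:
  fixes X :: "(bit ^ 'n) set"
  shows "x \<in> X \<Longrightarrow> x \<noteq> 0 \<Longrightarrow> min_weight X \<le> weight x"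
  unfolding min_weight_def by (intro Min_le) auto

text \<open>If the supports meet in m points, then \<open>x + y\<close> is a nonzero codeword of
  weight 16 - 2m, which must be at least 14.\<close>

lemma shadow_weight_8_meet_le_1:
  fixes C :: "(bit ^ 'n) set"
  assumes C: "self_dual C" "min_weight C = 14"
    and xy: "x \<in> shadow C" "y \<in> shadow C" "weight x = 8" "weight y = 8" "x \<noteq> y"
  shows "card (support x \<inter> support y) \<le> 1"
proof -
  have "x + y \<noteq> 0"
    using xy(5) by (metis add_right_cancel bit_vector_add_self)
  then have "14 \<le> weight (x + y)"
    using min_weight_le[OF add_shadow_in_code[OF C(1) xy(1,2)]] C(2) by simp
  then show ?thesis
    using weight_add[of x y] xy(3,4) by simp
qed

lemma card_orthogonal_shadow_weight_8:
  fixes C :: "(bit ^ 'n) set"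
  assumes n: "CARD('n) = 72" and C: "self_dual C" "min_weight C = 14"
    and A: "A \<subseteq> {x \<in> shadow C. weight x = 8}"
    and orth: "\<And>x y. x \<in> A \<Longrightarrow> y \<in> A \<Longrightarrow> scalar_product x y = 0"
  shows "card A \<le> 7"
proof (rule ccontr)
  assume "\<not> card A \<le> 7"
  then obtain F where F: "F \<subseteq> A" "card F = 8" "finite F"
    using obtain_subset_with_card_n[of 8 A] by auto
  have "support x \<inter> support y = {}" if "x \<in> F" "y \<in> F" "x \<noteq> y" for x y
  proof -
    have "x \<in> A" "y \<in> A"
      using that F(1) by auto
    then have "card (support x \<inter> support y) \<le> 1" "even (card (support x \<inter> support y))"
      using shadow_weight_8_meet_le_1[OF C] that A orth[of x y]
      by (auto simp: scalar_product_eq_0_iff)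
    then have "card (support x \<inter> support y) = 0"
      by presburger
    then show ?thesis
      by simp
  qed
  then have "weight (\<Sum>F) = (\<Sum>x\<in>F. weight x)"
    using weight_sum_disjoint[OF F(3)] by (simp add: pairwise_def)
  also have "\<dots> = (\<Sum>x\<in>F. 8)"
    using F(1) A by (intro sum.cong) auto
  finally have "weight (\<Sum>F) = 64"
    using F(2) by simp
  moreover have "support 1 = (UNIV :: 'n set)"
    by (auto simp: support_def)
  \<comment> \<open>Adding the all-ones vector complements the support: 72 - 64 = 8.\<close>
  ultimately have w: "weight (1 + \<Sum>F) = 8"
    using weight_add[of 1 "\<Sum>F"] n by (simp add: weight_eq_card_support)
  have "\<Sum>F \<in> C"
    using F A by (intro sum_shadow_in_code[OF C(1)]) auto
  then have "1 + \<Sum>F \<in> C"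
    using self_dual_add[OF C(1) self_dual_all_ones[OF C(1)]] by blast
  moreover have "1 + \<Sum>F \<noteq> 0"
    using w by auto
  ultimately show False
    using min_weight_le w C(2) by fastforce
qed

text \<open>The codeword \<open>x + y\<close> has weight 16 - 2m, where m is the size of the
  intersection of the supports. This is 0 mod 4 exactly when m is even, that is, when
  \<open>x\<close> and \<open>y\<close> are orthogonal. With \<open>z\<close> fixed, orthogonality
  thus becomes equality of the labels \<open>scalar_product z x\<close> and
  \<open>scalar_product z y\<close>.\<close>

lemma shadow_scalar_product_cocycle:
  assumes C: "self_dual C"
    and xyz: "x \<in> shadow C" "y \<in> shadow C" "z \<in> shadow C" "weight x = 8" "weight y = 8"
  shows "scalar_product z x + scalar_product z y = scalar_product x y"
proof -
  have "scalar_product z (x + y) = 0 \<longleftrightarrow> weight (x + y) mod 4 = 0"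
    using shadow_scalar_product[OF C xyz(3) add_shadow_in_code[OF C xyz(1,2)]] .
  also have "\<dots> \<longleftrightarrow> even (card (support x \<inter> support y))"
    using weight_add[of x y] xyz(4,5) by presburger
  also have "\<dots> \<longleftrightarrow> scalar_product x y = 0"
    by (simp add: scalar_product_eq_0_iff)
  finally show ?thesis
    by (metis bit_not_zero_iff scalar_product_add_right)
qed

lemma card_shadow_weight_8:
  fixes C :: "(bit ^ 'n) set"
  assumes n: "CARD('n) = 72" and C: "self_dual C" "min_weight C = 14"
  shows "card {x \<in> shadow C. weight x = 8} \<le> 14"
proof (cases "{x \<in> shadow C. weight x = 8} = {}")
  case True
  then show ?thesis
    by (metis card.empty zero_le)
next
  case False
  let ?W = "{x \<in> shadow C. weight x = 8}"
  \<comment> \<open>The product with the reference vector \<open>w\<close> labels each vector by a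
    bit; equal labels mean orthogonal vectors, whence two classes of at most 7.\<close>
  obtain w where w: "w \<in> shadow C"
    using False by blast
  let ?A = "\<lambda>b. {x \<in> ?W. scalar_product w x = b}"
  have le7: "card (?A b) \<le> 7" for b
  proof (rule card_orthogonal_shadow_weight_8[OF n C])
    fix x y assume "x \<in> ?A b" "y \<in> ?A b"
    then have "scalar_product x y = b + b"
      using shadow_scalar_product_cocycle[OF C(1) _ _ w, of x y] by simp
    then show "scalar_product x y = 0"
      by (simp add: bit_add_self)
  qed auto
  have "?W = ?A 0 \<union> ?A 1"
    by auto
  then have "card ?W \<le> card (?A 0) + card (?A 1)"
    using card_Un_le[of "?A 0" "?A 1"] by metis
  then show ?thesis
    using le7[of 0] le7[of 1] by linarith
qed

section \<open>Comparison with the enumerator coefficients\<close>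

lemma coeff_weight_enumerator:
  fixes X :: "(bit ^ 'n) set"
  shows "i \<le> CARD('n) \<Longrightarrow> coeff (weight_enumerator X) i = int (card {x \<in> X. weight x = i})"
  by (simp add: weight_enumerator_def coeff_sum)

theorem proposition12:
  fixes C :: "(bit ^ 'n) set" and \<alpha> :: int
  assumes "is_code C 72 36 14"
    and "singly_even_self_dual C"
    and "extremal C"
    and "min_weight (shadow C) \<ge> 8"
    and "poly_cutoff 17 (weight_enumerator C) =
      1 + monom (8640 - 64 * \<alpha>) 14 + monom (124281 + 384 * \<alpha>) 16"
    and "poly_cutoff 17 (weight_enumerator (shadow C)) =
      monom \<alpha> 8 + monom (546 - 14 * \<alpha>) 12 + monom (244584 + 91 * \<alpha>) 16"
  shows "0 \<le> \<alpha> \<and> \<alpha> \<le> 14"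
proof -
  have n: "CARD('n) = 72" and C: "self_dual C" "min_weight C = 14"
    using assms(1,2) by (simp_all add: is_code_def singly_even_self_dual_def)
  \<comment> \<open>Degree 8 lies below the cutoff 17, so truncation keeps this coefficient. Being a
    cardinality, it also yields the lower bound 0.\<close>
  have "coeff (weight_enumerator (shadow C)) 8 = \<alpha>"
    using arg_cong[OF assms(6), of "\<lambda>p. coeff p 8"] by (simp add: coeff_poly_cutoff)
  then have "\<alpha> = int (card {x \<in> shadow C. weight x = 8})"
    using n by (simp add: coeff_weight_enumerator)
  then show ?thesis
    using card_shadow_weight_8[OF n C] by simp
qed

end
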